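(* Let $\{a_n\}_{n\ge0}$ and $\{b_n\}_{n\ge0}$ be the sequences satisfying, for all $n\ge0$, $$(n+2)^2u_{n+2}-(32n^2+96n+76)u_{n+1}+256(n+1)^2u_n=0\quad(u_n=a_n\text{ or }b_n)$$ with initial values $a_0=1$, $a_1=12$, $b_0=0$, $b_1=1$. Then $$\left|\frac{b_n}{a_n}-\frac12L(2,\chi_{-1})\right|\ll\frac1{\log n}$$ as $n\to\infty$.
   Context: $\chi_{-1}$ is the odd Dirichlet character modulo $4$ ($\chi_{-1}(n)=(-1)^{(n-1)/2}$ for odd $n$, $0$ for even $n$), and $L(s,\chi_{-1})=\sum_{n\ge1}\chi_{-1}(n)n^{-s}$. $X_n\ll Y_n$ means $|X_n|\le CY_n$ for some constant $C$ and all large $n$. *)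

theory Defs
  imports "HOL-Analysis.Analysis" "HOL-Library.Landau_Symbols"
begin

definition chi_m1 :: "nat \<Rightarrow> real" where
  "chi_m1 n = (if odd n then (-1) ^ ((n - 1) div 2) else 0)"

text \<open>
  The sum starts at \<open>n = 1\<close>, hence the shift by \<open>Suc\<close>. For a non-principal
  character the natural order of summation gives the right value for all real \<open>s > 0\<close>, including
  the range where convergence is only conditional.
\<close>
definition dirichlet_L :: "real \<Rightarrow> (nat \<Rightarrow> real) \<Rightarrow> real" where
  "dirichlet_L s f = (\<Sum>n. f (Suc n) * real (Suc n) powr (-s))"

definition apery_like_rec :: "(nat \<Rightarrow> real) \<Rightarrow> bool" where
  "apery_like_rec u \<longleftrightarrow>
     (\<forall>n. (real n + 2)\<^sup>2 * u (n + 2)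
          - (32 * (real n)\<^sup>2 + 96 * real n + 76) * u (n + 1)
          + 256 * (real n + 1)\<^sup>2 * u n = 0)"

end

theory Submission
  imports Defs
begin

text \<open>
  After dividing by $16^n$ the recurrence is self-adjoint, and both exponents at infinity are
  $-1/2$: a generic solution behaves like $\log n/\sqrt n$ and a recessive one like $1/\sqrt n$.
  A recessive solution is $q_n=\frac{\pi}{8}\sum_j c_j^2\int_0^1(1-x^2)^n x^{2j}\,dx$ with
  $c_j=4^{-j}\binom{2j}{j}$: the recurrence holds because its summand telescopes in $j$.
  The boundary term of the telescoping, given by the Wallis product, yields
  $q_1=\frac34q_0-\frac1{16}$, and $q_0=\frac14\int_0^{\pi/2}\theta/\sin\theta\,d\theta
  =\frac12L(2,\chi_{-1})$. Comparing initial values, $b_n=\frac12L(2,\chi_{-1})a_n-16^nq_n$.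
  Since $q_n\le\frac12 n^{-1/2}$, the Casoratian of $a_n$ and $16^nq_n$ shows that
  $a_n/(16^nq_n)$ grows by at least $1/(16n)$ at each step, hence at least like $\frac1{16}\log n$.
\<close>

section \<open>Central binomial coefficients and beta integrals\<close>

text \<open>\<open>central_coeff j\<close> is $4^{-j}\binom{2j}{j}$.\<close>

primrec central_coeff :: "nat \<Rightarrow> real" where
  "central_coeff 0 = 1"
| "central_coeff (Suc j) = central_coeff j * ((2 * real j + 1) / (2 * real j + 2))"

text \<open>\<open>half_beta n j\<close> is $\int_0^1 (1-x^2)^n x^{2j}\,dx$.\<close>

primrec half_beta :: "nat \<Rightarrow> nat \<Rightarrow> real" where
  "half_beta 0 j = 1 / (2 * real j + 1)"
| "half_beta (Suc n) j = half_beta n j * ((2 * real n + 2) / (2 * real n + 2 * real j + 3))"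

lemma central_coeff_pos: "central_coeff j > 0"
  by (induction j) auto

lemma central_coeff_le_1: "central_coeff j \<le> 1"
proof (induction j)
  case (Suc j)
  have "central_coeff j * ((2 * real j + 1) / (2 * real j + 2)) \<le> 1 * 1"
    by (intro mult_mono Suc.IH) auto
  then show ?case by simp
qed simp

text \<open>The decay in \<open>j\<close> that \<open>half_beta 0 j\<close>, of order only 1/j,
  lacks for summability; it also makes the later boundary term vanish and supplies the exponent 3/2
  of a majorant.\<close>

lemma central_coeff_square_le: "(central_coeff j)\<^sup>2 \<le> 1 / (real j + 1)"
proof (induction j)
  case (Suc j)
  have "(central_coeff (Suc j))\<^sup>2 = (central_coeff j)\<^sup>2 * ((2 * real j + 1) / (2 * real j + 2))\<^sup>2"
    by (simp add: power_mult_distrib power_divide)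
  also have "\<dots> \<le> 1 / (real j + 1) * ((2 * real j + 1) / (2 * real j + 2))\<^sup>2"
    by (intro mult_right_mono Suc.IH) auto
  also have "\<dots> \<le> 1 / (real (Suc j) + 1)"
  proof -
    have "(2 * real j + 1)\<^sup>2 * (real j + 2) \<le> (2 * real j + 2)\<^sup>2 * (real j + 1)"
      by (simp add: power2_eq_square algebra_simps)
    then show ?thesis
      by (simp add: power_divide divide_simps) (simp add: algebra_simps)
  qed
  finally show ?case .
qed simp

text \<open>The Wallis factors are (2k)^2 / ((2k-1)(2k+1)), so their partial products are the
  reciprocals of this sequence. The exact limit is what fixes the constant 1/16 in
  \<open>recessive_sol_1\<close>.\<close>

lemma central_coeff_square_tendsto:
  "(\<lambda>j. (central_coeff j)\<^sup>2 * (2 * real j + 1)) \<longlonglongrightarrow> 2 / pi"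
proof -
  have eq: "(\<Prod>k=1..j. (4 * real k ^ 2) / (4 * real k ^ 2 - 1))
      = inverse ((central_coeff j)\<^sup>2 * (2 * real j + 1))" for j
  proof (induction j)
    case (Suc j)
    have "4 * (real (Suc j))\<^sup>2 - 1 = (2 * real j + 1) * (2 * real j + 3)"
      "(2 * real j + 2)\<^sup>2 = 4 * (real (Suc j))\<^sup>2"
      by (simp_all add: power2_eq_square algebra_simps)
    then show ?case
      using Suc.IH central_coeff_pos[of j]
      by (simp add: power_mult_distrib power_divide field_simps)
        (simp add: power2_eq_square algebra_simps)
  qed simp
  from tendsto_inverse[OF wallis[unfolded eq]] show ?thesis
    by simp
qed

lemma half_beta_pos: "half_beta n j > 0"
  by (induction n) auto

text \<open>The definition recurses in \<open>n\<close>; telescoping in \<open>j\<close> needs the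
  ratio in the other direction.\<close>

lemma half_beta_Suc_right:
  "half_beta n (Suc j) = half_beta n j * ((2 * real j + 1) / (2 * real n + 2 * real j + 3))"
proof (induction n)
  case (Suc n)
  have "2 * real n + 2 * real j + 3 \<noteq> 0" "2 * real n + 2 * real j + 5 \<noteq> 0" by linarith+
  then show ?case
    by (simp add: Suc.IH divide_simps)
qed (simp add: field_simps)

text \<open>Under the integral this is 1 - x^2 applied as one more factor and expanded.\<close>

lemma half_beta_Suc_left: "half_beta (Suc n) j = half_beta n j - half_beta n (Suc j)"
  unfolding half_beta_Suc_right by (simp add: field_simps)

lemma half_beta_Suc_le: "half_beta (Suc n) j \<le> half_beta n j"
  using half_beta_pos[of n "Suc j"] by (simp add: half_beta_Suc_left del: half_beta.simps)

lemma half_beta_antimono: "m \<le> n \<Longrightarrow> half_beta n j \<le> half_beta m j"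
  by (rule lift_Suc_antimono_le[of "\<lambda>n. half_beta n j"]) (simp_all add: half_beta_Suc_le del: half_beta.simps)

lemma half_beta_tendsto_0: "half_beta n \<longlonglongrightarrow> 0"
proof (rule tendsto_sandwich[OF _ _ tendsto_const LIMSEQ_inverse_real_of_nat])
  show "\<forall>\<^sub>F j in sequentially. 0 \<le> half_beta n j"
    by (simp add: half_beta_pos less_imp_le)
  have "half_beta n j \<le> inverse (real (Suc j))" for j
  proof -
    have "half_beta n j \<le> half_beta 0 j" by (rule half_beta_antimono) simp
    also have "\<dots> \<le> inverse (real (Suc j))" by (simp add: field_simps)
    finally show ?thesis .
  qed
  then show "\<forall>\<^sub>F j in sequentially. half_beta n j \<le> inverse (real (Suc j))"
    by simp
qed

text \<open>Under the integral, the geometric series of x^2 cancels one factor 1 - x^2; here it is a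
  telescoping sum.\<close>

lemma half_beta_sums: "half_beta (Suc n) sums half_beta n 0"
  using telescope_sums'[OF half_beta_tendsto_0[of n]]
  unfolding half_beta_Suc_left[symmetric] by (simp del: half_beta.simps)

lemma half_beta_0_square_le: "(half_beta n 0)\<^sup>2 \<le> 1 / (real n + 1)"
proof (induction n)
  case (Suc n)
  have "(half_beta (Suc n) 0)\<^sup>2 = (half_beta n 0)\<^sup>2 * ((2 * real n + 2) / (2 * real n + 3))\<^sup>2"
    by (simp add: power_mult_distrib power_divide)
  also have "\<dots> \<le> 1 / (real n + 1) * ((2 * real n + 2) / (2 * real n + 3))\<^sup>2"
    by (intro mult_right_mono Suc.IH) auto
  also have "\<dots> \<le> 1 / (real (Suc n) + 1)"
  proof -
    have "(2 * real n + 2)\<^sup>2 * (real n + 2) \<le> (2 * real n + 3)\<^sup>2 * (real n + 1)"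
      by (simp add: power2_eq_square algebra_simps)
    then show ?thesis
      by (simp add: power_divide divide_simps) (simp add: algebra_simps)
  qed
  finally show ?case .
qed simp

section \<open>The recessive solution: convergence and size\<close>

text \<open>The squares of \<open>central_coeff\<close> are the Taylor coefficients in x^2 of 2K/pi,
  K being the complete elliptic integral; hence the factor pi/8 = (1/4)(pi/2) in
  \<open>recessive_sol\<close>.\<close>

definition recessive_term :: "nat \<Rightarrow> nat \<Rightarrow> real" where
  "recessive_term n j = (central_coeff j)\<^sup>2 * half_beta n j"

text \<open>With \<open>K\<close> the complete elliptic integral of modulus \<open>x\<close>, this is
  $\frac14\int_0^1 (1-x^2)^n K(x)\,dx$.\<close>

definition recessive_sol :: "nat \<Rightarrow> real" where
  "recessive_sol n = pi / 8 * (\<Sum>j. recessive_term n j)"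

lemma recessive_term_pos: "recessive_term n j > 0"
  unfolding recessive_term_def by (intro mult_pos_pos zero_less_power central_coeff_pos half_beta_pos)

lemma recessive_term_le: "recessive_term n j \<le> half_beta n j"
  using mult_right_mono[of "(central_coeff j)\<^sup>2" 1 "half_beta n j"] central_coeff_le_1[of j]
    central_coeff_pos[of j] half_beta_pos[of n j]
  by (simp add: recessive_term_def power_le_one)

lemma summable_inverse_Suc_square: "summable (\<lambda>j. inverse (real (Suc j) ^ 2))"
  using inverse_power_summable[of 2, where 'a = real]
  by (subst summable_Suc_iff) simp

lemma summable_recessive_term: "summable (recessive_term n)"
proof (rule summable_comparison_test')
  show "summable (\<lambda>j. inverse (real (Suc j) ^ 2))"
    by (rule summable_inverse_Suc_square)
  fix j
  have "norm (recessive_term n j) = recessive_term n j"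
    using recessive_term_pos[of n j] by simp
  also have "\<dots> \<le> 1 / (real j + 1) * half_beta 0 j"
    unfolding recessive_term_def using half_beta_pos[of n j]
    by (intro mult_mono central_coeff_square_le half_beta_antimono) auto
  also have "\<dots> \<le> 1 / (real j + 1) * (1 / (real j + 1))"
    by (intro mult_left_mono) (auto simp: field_simps)
  finally show "norm (recessive_term n j) \<le> inverse (real (Suc j) ^ 2)"
    by (simp add: field_simps power2_eq_square)
qed

lemma recessive_sol_pos: "recessive_sol n > 0"
  unfolding recessive_sol_def using suminf_pos[OF summable_recessive_term recessive_term_pos] by simp

text \<open>Bounding the squared coefficients by 1 leaves a series with a closed sum, one index
  lower in \<open>n\<close>, and does not spoil the order n^(-1/2).\<close>

lemma recessive_sol_Suc_le: "recessive_sol (Suc n) \<le> 1 / 2 * half_beta n 0"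
proof -
  have "(\<Sum>j. recessive_term (Suc n) j) \<le> (\<Sum>j. half_beta (Suc n) j)"
    by (intro suminf_le recessive_term_le summable_recessive_term sums_summable[OF half_beta_sums])
  also have "\<dots> = half_beta n 0"
    by (rule sums_unique[symmetric, OF half_beta_sums])
  finally have "(\<Sum>j. recessive_term (Suc n) j) \<le> half_beta n 0" .
  then have "recessive_sol (Suc n) \<le> pi / 8 * half_beta n 0"
    unfolding recessive_sol_def by (intro mult_left_mono) auto
  also have "\<dots> \<le> 1 / 2 * half_beta n 0"
    using pi_less_4 half_beta_pos[of n 0] by (intro mult_right_mono) auto
  finally show ?thesis .
qed

text \<open>This product is the denominator when consecutive quotients of a solution by the
  recessive one are subtracted.\<close>

lemma recessive_sol_mult_Suc_le:
  assumes "n \<ge> 1"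
  shows "recessive_sol n * recessive_sol (Suc n) \<le> 1 / (4 * real n)"
proof -
  obtain m where m: "n = Suc m" using assms by (cases n) auto
  have "recessive_sol n * recessive_sol (Suc n) \<le> (1 / 2 * half_beta m 0) * (1 / 2 * half_beta m 0)"
    unfolding m
    using recessive_sol_Suc_le[of m] recessive_sol_Suc_le[of "Suc m"] half_beta_Suc_le[of m 0]
      recessive_sol_pos[of "Suc (Suc m)"] half_beta_pos[of m 0]
    by (intro mult_mono) (auto simp del: half_beta.simps)
  also have "\<dots> = (half_beta m 0)\<^sup>2 / 4" by (simp add: power2_eq_square)
  also have "\<dots> \<le> 1 / (4 * real n)"
    using half_beta_0_square_le[of m] by (simp add: m field_simps)
  finally show ?thesis .
qed

section \<open>Recurrence and first value by creative telescoping\<close>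

text \<open>The left side is the recurrence rescaled by powers of 16, so that 76/16 = 19/4; the
  certificate is j^2 times the middle term. Once the common factor \<open>c * h\<close> is removed,
  a rational identity in \<open>x\<close> and \<open>y\<close> remains.\<close>

lemma recessive_term_telescope:
  "(real n + 2)\<^sup>2 * recessive_term (n + 2) j - (2 * (real n)\<^sup>2 + 6 * real n + 19 / 4) * recessive_term (n + 1) j
     + (real n + 1)\<^sup>2 * recessive_term n j
   = (real j)\<^sup>2 * recessive_term (n + 1) j - (real (Suc j))\<^sup>2 * recessive_term (n + 1) (Suc j)"
proof -
  define c h x y where "c = (central_coeff j)\<^sup>2" "h = half_beta n j" "x = real n" "y = real j"
  have nz: "2 * x + 2 * y + 3 > 0" "2 * x + 2 * y + 5 > 0" "y + 1 > 0" "2 * y + 2 > 0"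
    by (simp_all add: c_h_x_y_def)
  have 1: "recessive_term (n + 1) j = c * h * ((2 * x + 2) / (2 * x + 2 * y + 3))"
    by (simp add: recessive_term_def c_h_x_y_def)
  have 2: "recessive_term (n + 2) j
      = c * h * ((2 * x + 2) / (2 * x + 2 * y + 3)) * ((2 * x + 4) / (2 * x + 2 * y + 5))"
    by (simp add: recessive_term_def c_h_x_y_def numeral_2_eq_2 algebra_simps)
  have 3: "recessive_term (n + 1) (Suc j) = c * h * ((2 * x + 2) / (2 * x + 2 * y + 3))
      * ((2 * y + 1) / (2 * y + 2))\<^sup>2 * ((2 * y + 1) / (2 * x + 2 * y + 5))"
  proof -
    have "2 * real (n + 1) + 2 * real j + 3 = 2 * x + 2 * y + 5" by (simp add: c_h_x_y_def)
    then show ?thesis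
      unfolding recessive_term_def half_beta_Suc_right central_coeff.simps power_mult_distrib
      by (simp add: c_h_x_y_def mult_ac add_ac)
  qed
  have 4: "recessive_term n j = c * h" by (simp add: recessive_term_def c_h_x_y_def)
  have "(x + 2)\<^sup>2 * (((2 * x + 2) / (2 * x + 2 * y + 3)) * ((2 * x + 4) / (2 * x + 2 * y + 5)))
      - (2 * x\<^sup>2 + 6 * x + 19 / 4) * ((2 * x + 2) / (2 * x + 2 * y + 3)) + (x + 1)\<^sup>2
     = y\<^sup>2 * ((2 * x + 2) / (2 * x + 2 * y + 3)) - (y + 1)\<^sup>2 * (((2 * x + 2) / (2 * x + 2 * y + 3))
      * ((2 * y + 1) / (2 * y + 2))\<^sup>2 * ((2 * y + 1) / (2 * x + 2 * y + 5)))"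
    using nz by (simp add: power_divide power_mult_distrib divide_simps) algebra
  then have "c * h * ((x + 2)\<^sup>2 * (((2 * x + 2) / (2 * x + 2 * y + 3)) * ((2 * x + 4) / (2 * x + 2 * y + 5)))
      - (2 * x\<^sup>2 + 6 * x + 19 / 4) * ((2 * x + 2) / (2 * x + 2 * y + 3)) + (x + 1)\<^sup>2)
     = c * h * (y\<^sup>2 * ((2 * x + 2) / (2 * x + 2 * y + 3)) - (y + 1)\<^sup>2 * (((2 * x + 2) / (2 * x + 2 * y + 3))
      * ((2 * y + 1) / (2 * y + 2))\<^sup>2 * ((2 * y + 1) / (2 * x + 2 * y + 5))))"
    by simp
  moreover have "real (Suc j) = y + 1" "real n = x" "real j = y" by (simp_all add: c_h_x_y_def)
  ultimately show ?thesis
    unfolding 1 2 3 4 by (simp only: distrib_left right_diff_distrib mult_1_right mult_ac)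
qed

text \<open>Formally the previous identity at n = -1: the last coefficient vanishes and the middle
  one becomes 2 - 6 + 19/4 = 3/4.\<close>

lemma recessive_term_telescope_0:
  "recessive_term 1 j - 3 / 4 * recessive_term 0 j
   = (real j)\<^sup>2 * recessive_term 0 j - (real (Suc j))\<^sup>2 * recessive_term 0 (Suc j)"
proof -
  define c h y where "c = (central_coeff j)\<^sup>2" "h = half_beta 0 j" "y = real j"
  have nz: "2 * y + 3 > 0" "2 * y + 2 > 0"
    by (simp_all add: c_h_y_def)
  have 1: "recessive_term 1 j = c * h * (2 / (2 * y + 3))"
    by (simp add: recessive_term_def c_h_y_def)
  have 3: "recessive_term 0 (Suc j) = c * h * ((2 * y + 1) / (2 * y + 2))\<^sup>2 * ((2 * y + 1) / (2 * y + 3))"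
    unfolding recessive_term_def half_beta_Suc_right central_coeff.simps power_mult_distrib
    by (simp add: c_h_y_def del: half_beta.simps)
  have 4: "recessive_term 0 j = c * h" by (simp add: recessive_term_def c_h_y_def)
  have "2 / (2 * y + 3) - 3 / 4
     = y\<^sup>2 - (y + 1)\<^sup>2 * (((2 * y + 1) / (2 * y + 2))\<^sup>2 * ((2 * y + 1) / (2 * y + 3)))"
    using nz by (simp add: power_divide power_mult_distrib divide_simps) algebra
  then have "c * h * (2 / (2 * y + 3) - 3 / 4)
     = c * h * (y\<^sup>2 - (y + 1)\<^sup>2 * (((2 * y + 1) / (2 * y + 2))\<^sup>2 * ((2 * y + 1) / (2 * y + 3))))"
    by simp
  moreover have "real (Suc j) = y + 1" "real j = y" by (simp_all add: c_h_y_def)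
  ultimately show ?thesis
    unfolding 1 3 4 by (simp only: right_diff_distrib mult_ac)
qed

lemma recessive_sol_rec:
  "(real n + 2)\<^sup>2 * recessive_sol (n + 2) - (2 * (real n)\<^sup>2 + 6 * real n + 19 / 4) * recessive_sol (n + 1)
     + (real n + 1)\<^sup>2 * recessive_sol n = 0"
proof -
  let ?f = "\<lambda>j. (real j)\<^sup>2 * recessive_term (n + 1) j"
  \<comment> \<open>Since n + 1 is at least 1, the beta factor is O(1/j^2) and absorbs j^2; the
    squared coefficient still gives 1/(j+1).\<close>
  have "?f \<longlonglongrightarrow> 0"
  proof (rule tendsto_sandwich[OF _ _ tendsto_const LIMSEQ_inverse_real_of_nat])
    show "\<forall>\<^sub>F j in sequentially. 0 \<le> ?f j"
      by (simp add: recessive_term_pos less_imp_le)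
    have "?f j \<le> inverse (real (Suc j))" for j
    proof -
      have "recessive_term (n + 1) j \<le> 1 / (real j + 1) * half_beta 1 j"
        unfolding recessive_term_def using half_beta_pos[of "n + 1" j]
        by (intro mult_mono central_coeff_square_le half_beta_antimono) auto
      then have "?f j \<le> (real j)\<^sup>2 * (1 / (real j + 1) * half_beta 1 j)"
        by (rule mult_left_mono) simp
      also have "\<dots> = 1 / (real j + 1) * ((real j)\<^sup>2 * half_beta 1 j)"
        by simp
      also have "\<dots> \<le> 1 / (real j + 1) * 1"
      proof (intro mult_left_mono)
        show "(real j)\<^sup>2 * half_beta 1 j \<le> 1"
          by (simp add: divide_le_eq power2_eq_square) (simp add: algebra_simps)
      qed simp
      finally show ?thesis by (simp add: inverse_eq_divide add_ac)
    qed
    then show "\<forall>\<^sub>F j in sequentially. ?f j \<le> inverse (real (Suc j))" by simp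
  qed
  from telescope_sums'[OF this]
  have "(\<lambda>j. (real n + 2)\<^sup>2 * recessive_term (n + 2) j
      - (2 * (real n)\<^sup>2 + 6 * real n + 19 / 4) * recessive_term (n + 1) j
      + (real n + 1)\<^sup>2 * recessive_term n j) sums 0"
    unfolding recessive_term_telescope by simp
  moreover have "(\<lambda>j. (real n + 2)\<^sup>2 * recessive_term (n + 2) j
      - (2 * (real n)\<^sup>2 + 6 * real n + 19 / 4) * recessive_term (n + 1) j
      + (real n + 1)\<^sup>2 * recessive_term n j) sums
     ((real n + 2)\<^sup>2 * (\<Sum>j. recessive_term (n + 2) j)
      - (2 * (real n)\<^sup>2 + 6 * real n + 19 / 4) * (\<Sum>j. recessive_term (n + 1) j)
      + (real n + 1)\<^sup>2 * (\<Sum>j. recessive_term n j))"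
    by (intro sums_add sums_diff sums_mult summable_sums summable_recessive_term)
  ultimately have "(real n + 2)\<^sup>2 * (\<Sum>j. recessive_term (n + 2) j)
      - (2 * (real n)\<^sup>2 + 6 * real n + 19 / 4) * (\<Sum>j. recessive_term (n + 1) j)
      + (real n + 1)\<^sup>2 * (\<Sum>j. recessive_term n j) = 0"
    using sums_unique2 by blast
  from arg_cong[where f = "\<lambda>x. pi / 8 * x", OF this] show ?thesis
    unfolding recessive_sol_def by (simp only: distrib_left right_diff_distrib mult_zero_right mult_ac)
qed

text \<open>Here the beta factor is only 1/(2j+1), so the boundary term survives: its limit is
  (2/pi)(1/4) = 1/(2 pi), and pi/8 times this is 1/16.\<close>

lemma recessive_sol_1: "recessive_sol 1 = 3 / 4 * recessive_sol 0 - 1 / 16"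
proof -
  let ?f = "\<lambda>j. (real j)\<^sup>2 * recessive_term 0 j"
  have "(\<lambda>j. 1 / 2 * (1 - half_beta 0 j)) \<longlonglongrightarrow> 1 / 2 * (1 - 0)"
    by (intro tendsto_intros half_beta_tendsto_0)
  moreover have "1 / 2 * (1 - half_beta 0 j) = real j / (2 * real j + 1)" for j
    by (simp add: field_simps)
  ultimately have "(\<lambda>j. real j / (2 * real j + 1)) \<longlonglongrightarrow> 1 / 2"
    by (simp only: diff_zero mult_1_right)
  from tendsto_mult[OF central_coeff_square_tendsto tendsto_power[OF this, of 2]]
  have "(\<lambda>j. (central_coeff j)\<^sup>2 * (2 * real j + 1) * (real j / (2 * real j + 1))\<^sup>2) \<longlonglongrightarrow> 1 / (2 * pi)"
    by (simp add: power2_eq_square)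
  moreover have "(central_coeff j)\<^sup>2 * (2 * real j + 1) * (real j / (2 * real j + 1))\<^sup>2 = ?f j" for j
    by (simp add: recessive_term_def power_divide power2_eq_square)
  ultimately have "?f \<longlonglongrightarrow> 1 / (2 * pi)" by simp
  from telescope_sums'[OF this]
  have "(\<lambda>j. recessive_term 1 j - 3 / 4 * recessive_term 0 j) sums (- (1 / (2 * pi)))"
    unfolding recessive_term_telescope_0 by simp
  moreover have "(\<lambda>j. recessive_term 1 j - 3 / 4 * recessive_term 0 j) sums
      ((\<Sum>j. recessive_term 1 j) - 3 / 4 * (\<Sum>j. recessive_term 0 j))"
    by (intro sums_diff sums_mult summable_sums summable_recessive_term)
  ultimately have "(\<Sum>j. recessive_term 1 j) - 3 / 4 * (\<Sum>j. recessive_term 0 j) = - (1 / (2 * pi))"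
    using sums_unique2 by blast
  then show ?thesis
    unfolding recessive_sol_def by (simp add: field_simps)
qed


section \<open>Power series of arcsin and Wallis integrals\<close>

lemma summable_power_series_bounded:
  fixes p :: "nat \<Rightarrow> real"
  assumes p: "\<And>j. \<bar>p j\<bar> \<le> 1" and x: "\<bar>x\<bar> < 1"
  shows "summable (\<lambda>j. p j * x ^ j)"
proof (rule summable_comparison_test')
  show "summable (\<lambda>j. \<bar>x\<bar> ^ j)" using x by (simp add: summable_geometric)
  show "norm (p j * x ^ j) \<le> \<bar>x\<bar> ^ j" for j
    using mult_right_mono[OF p[of j], of "\<bar>x\<bar> ^ j"] by (simp add: abs_mult power_abs)
qed

text \<open>Kept general in \<open>p\<close> to serve both the arcsin series and the inverse tangent
  integral.\<close>

lemma odd_power_series_has_derivative: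
  fixes p :: "nat \<Rightarrow> real"
  assumes p: "\<And>j. \<bar>p j\<bar> \<le> 1" and x: "\<bar>x\<bar> < 1"
  shows "((\<lambda>x. \<Sum>j. p j / (2 * real j + 1) * x ^ (2 * j + 1))
    has_real_derivative (\<Sum>j. p j * x ^ (2 * j))) (at x)"
proof -
  \<comment> \<open>\<open>f n\<close> is the coefficient of x^(n+1), so the odd powers sit at even
    \<open>n\<close>.\<close>
  define f :: "nat \<Rightarrow> real" where "f n = (if even n then p (n div 2) / real (Suc n) else 0)" for n
  have mono: "strict_mono (\<lambda>j::nat. 2 * j)" by (simp add: strict_mono_def)
  have notin: "odd n" if "n \<notin> range (\<lambda>j::nat. 2 * j)" for n
    using that by (auto elim!: evenE)
  have 1: "(\<Sum>n. f n * y ^ Suc n) = (\<Sum>j. p j / (2 * real j + 1) * y ^ (2 * j + 1))" for y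
    by (subst suminf_mono_reindex[OF mono, symmetric])
      (auto simp: f_def add_ac dest: notin)
  have 2: "(\<Sum>n. f n * real (Suc n) * y ^ n) = (\<Sum>j. p j * y ^ (2 * j))" for y
    by (subst suminf_mono_reindex[OF mono, symmetric])
      (auto simp: f_def add_ac dest: notin simp del: of_nat_Suc)
  have "((\<lambda>x. \<Sum>n. f n * x ^ Suc n) has_real_derivative (\<Sum>n. f n * real (Suc n) * x ^ n)) (at x)"
  proof (rule DERIV_power_series'[where R = 1])
    fix y :: real assume "y \<in> {-1<..<1}"
    then have "\<bar>y\<bar> < 1" by auto
    moreover have "\<bar>f n * real (Suc n)\<bar> \<le> 1" for n
      using p[of "n div 2"] by (simp add: f_def del: of_nat_Suc)
    ultimately show "summable (\<lambda>n. f n * real (Suc n) * y ^ n)"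
      by (intro summable_power_series_bounded)
  qed (use x in auto)
  then show ?thesis unfolding 1 2 .
qed

lemma central_coeff_gbinomial: "(- 1 / 2 gchoose j) = (- 1) ^ j * central_coeff j"
proof (induction j)
  case (Suc j)
  have "(- 1 / 2 - real j) * (- 1 / 2 gchoose j) = real (Suc j) * (- 1 / 2 gchoose Suc j)"
    using gbinomial_mult_1[of "- 1 / 2 :: real" j] by (simp add: algebra_simps)
  then have "(- 1 / 2 gchoose Suc j) = (- 1 / 2 - real j) * (- 1 / 2 gchoose j) / real (Suc j)"
    by (simp add: field_simps)
  also have "\<dots> = (- 1) ^ Suc j * central_coeff (Suc j)"
    unfolding Suc.IH by (simp add: field_simps)
  finally show ?case .
qed simp

lemma suminf_central_coeff:
  assumes "\<bar>x\<bar> < 1"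
  shows "(\<Sum>j. central_coeff j * x ^ (2 * j)) = 1 / sqrt (1 - x\<^sup>2)"
proof -
  have x2: "x\<^sup>2 < 1" using assms by (simp add: abs_square_less_1)
  then have "(\<lambda>j. (- 1 / 2 gchoose j) * (- (x\<^sup>2)) ^ j) sums (1 + - (x\<^sup>2)) powr (- 1 / 2)"
    by (intro gen_binomial_real) simp
  moreover have "(- 1 / 2 gchoose j) * (- (x\<^sup>2)) ^ j = central_coeff j * x ^ (2 * j)" for j
  proof -
    have "(- (x\<^sup>2)) ^ j = (- 1) ^ j * x ^ (2 * j)"
      by (subst power_minus) (simp add: power_mult)
    then show ?thesis unfolding central_coeff_gbinomial by (simp add: mult_ac)
  qed
  moreover have "(1 + - (x\<^sup>2)) powr (- 1 / 2) = 1 / sqrt (1 - x\<^sup>2)"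
    using x2 by (simp add: powr_minus powr_half_sqrt inverse_eq_divide)
  ultimately show ?thesis by (simp add: sums_iff)
qed

text \<open>Both sides vanish at 0 and have derivative 1 / sqrt (1 - y^2), by the binomial
  series.\<close>

lemma arcsin_series:
  assumes "0 \<le> x" "x < 1"
  shows "(\<Sum>j. central_coeff j / (2 * real j + 1) * x ^ (2 * j + 1)) = arcsin x"
proof (cases "x = 0")
  case False
  define A where "A x = (\<Sum>j. central_coeff j / (2 * real j + 1) * x ^ (2 * j + 1))" for x
  have der: "((\<lambda>x. A x - arcsin x) has_real_derivative 0) (at y)" if "\<bar>y\<bar> < 1" for y
  proof -
    have "(A has_real_derivative (\<Sum>j. central_coeff j * y ^ (2 * j))) (at y)"
      unfolding A_def
      by (intro odd_power_series_has_derivative that)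
        (simp add: central_coeff_pos[THEN less_imp_le] central_coeff_le_1)
    moreover have "(arcsin has_real_derivative inverse (sqrt (1 - y\<^sup>2))) (at y)"
      using that by (intro DERIV_arcsin) auto
    ultimately show ?thesis
      using DERIV_diff suminf_central_coeff[OF that] by (fastforce simp: inverse_eq_divide)
  qed
  have "A x - arcsin x = A 0 - arcsin 0"
  proof (rule DERIV_isconst_end[where f = "\<lambda>x. A x - arcsin x"])
    show "continuous_on {0..x} (\<lambda>x. A x - arcsin x)"
      using assms by (intro DERIV_atLeastAtMost_imp_continuous_on exI[of _ 0] der) auto
  qed (use assms False der in auto)
  then show ?thesis by (simp add: A_def)
qed simp

lemma has_integral_sin_power:
  "((\<lambda>t. sin t ^ (2 * j)) has_integral (pi / 2 * central_coeff j)) {0..pi / 2}"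
proof (induction j)
  case 0
  show ?case using has_integral_const_real[of "1::real" 0 "pi / 2"] by simp
next
  case (Suc j)
  \<comment> \<open>\<open>?f\<close> vanishes at both endpoints, so integrating its derivative
    yields the reduction formula.\<close>
  let ?f = "\<lambda>t::real. sin t ^ (2 * j + 1) * cos t"
  let ?f' = "\<lambda>t::real. (2 * real j + 1) * sin t ^ (2 * j) - (2 * real j + 2) * sin t ^ (2 * Suc j)"
  have "(?f' has_integral ?f (pi / 2) - ?f 0) {0..pi / 2}"
  proof (rule fundamental_theorem_of_calculus)
    fix t :: real
    have "(?f has_real_derivative
       (real (2 * j + 1) * sin t ^ (2 * j) * cos t * cos t + sin t ^ (2 * j + 1) * (- sin t))) (at t)"
      by (rule DERIV_cong[OF DERIV_mult[OF DERIV_power[OF DERIV_sin] DERIV_cos]]) (simp add: algebra_simps)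
    also have "real (2 * j + 1) * sin t ^ (2 * j) * cos t * cos t + sin t ^ (2 * j + 1) * (- sin t)
      = (2 * real j + 1) * sin t ^ (2 * j) * (cos t)\<^sup>2 - sin t ^ (2 * Suc j)"
      by (simp add: power2_eq_square)
    also have "\<dots> = ?f' t"
      unfolding cos_squared_eq by (simp add: power2_eq_square algebra_simps)
    finally show "(?f has_vector_derivative ?f' t) (at t within {0..pi / 2})"
      by (simp only: has_real_derivative_iff_has_vector_derivative has_vector_derivative_at_within)
  qed simp
  then have f': "(?f' has_integral 0) {0..pi / 2}" by simp
  have "((\<lambda>t. ((2 * real j + 1) * sin t ^ (2 * j) - ?f' t) / (2 * real j + 2)) has_integral
     ((2 * real j + 1) * (pi / 2 * central_coeff j) - 0) / (2 * real j + 2)) {0..pi / 2}"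
    by (intro has_integral_divide has_integral_diff has_integral_mult_right f' Suc.IH)
  then show ?case by (simp add: mult_ac)
qed

section \<open>The initial value as an L-value\<close>

text \<open>The integral of t / sin t over [0, pi/2] is computed twice: termwise from the arcsin
  series at sin t, and through a primitive obtained by the half-angle substitution.\<close>

lemma suminf_catalan_central_coeff:
  "(\<Sum>j. (central_coeff j)\<^sup>2 / (2 * real j + 1)) * (pi / 2) = 2 * (\<Sum>k. (- 1) ^ k / (2 * real k + 1)\<^sup>2)"
proof -
  define p :: "nat \<Rightarrow> real" where "p k = (- 1) ^ k / (2 * real k + 1)" for k
  \<comment> \<open>The inverse tangent integral: its derivative is arctan x / x and
    \<open>T 1\<close> is Catalan's constant.\<close>
  define T where "T x = (\<Sum>k. p k / (2 * real k + 1) * x ^ (2 * k + 1))" for x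
  have p_le: "\<bar>p k\<bar> \<le> 1" for k by (simp add: p_def power_abs)
  have T_cont: "continuous_on {0..1} T"
    unfolding T_def
  proof (rule uniform_limit_theorem[OF _ Weierstrass_m_test[OF _ summable_inverse_Suc_square]])
    fix k and x :: real assume x: "x \<in> {0..1}"
    have "norm (p k / (2 * real k + 1) * x ^ (2 * k + 1)) = 1 / (2 * real k + 1)\<^sup>2 * x ^ (2 * k + 1)"
      using x by (simp add: p_def abs_mult power_abs power2_eq_square)
    also have "\<dots> \<le> 1 / (2 * real k + 1)\<^sup>2 * 1"
      using x by (intro mult_left_mono power_le_one) auto
    also have "\<dots> \<le> inverse (real (Suc k) ^ 2)"
      by (simp add: inverse_eq_divide frac_le power_mono)
    finally show "norm (p k / (2 * real k + 1) * x ^ (2 * k + 1)) \<le> inverse (real (Suc k) ^ 2)" .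
  qed (auto intro!: always_eventually continuous_intros)
  have T_der: "(T has_real_derivative arctan x / x) (at x)" if "0 < x" "x < 1" for x
  proof -
    have "arctan x / x = (\<Sum>k. p k * x ^ (2 * k))"
    proof -
      have "arctan x = (\<Sum>k. (-1) ^ k * (1 / real (k * 2 + 1) * x ^ (k * 2 + 1)))"
        using that by (intro arctan_series) auto
      also have "\<dots> = (\<Sum>k. x * (p k * x ^ (2 * k)))"
        by (simp add: p_def mult_ac add_ac)
      also have "\<dots> = x * (\<Sum>k. p k * x ^ (2 * k))"
      proof (rule suminf_mult)
        show "summable (\<lambda>k. p k * x ^ (2 * k))"
          unfolding power_mult using that p_le
          by (intro summable_power_series_bounded) (auto simp: abs_square_less_1)
      qed
      finally show ?thesis using that by simp
    qed
    then show ?thesis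
      unfolding T_def using odd_power_series_has_derivative[OF p_le, of x] that by simp
  qed
  let ?F = "\<lambda>t. 2 * T (tan (t / 2))"
  let ?g = "\<lambda>t. \<Sum>j. central_coeff j / (2 * real j + 1) * sin t ^ (2 * j)"
  have tan01: "0 < tan (t / 2)" "tan (t / 2) < 1" if "0 < t" "t < pi / 2" for t
    using that tan_gt_zero[of "t / 2"] tan_monotone[of "t / 2" "pi / 4"] by (auto simp: tan_45)
  \<comment> \<open>\<open>?g t\<close> equals t / sin t inside the interval; the interior form of
    the theorem avoids evaluating it at the endpoints.\<close>
  have g: "(?g has_integral (?F (pi / 2) - ?F 0)) {0..pi / 2}"
  proof (rule fundamental_theorem_of_calculus_interior)
    have "continuous_on {0..pi / 2} (\<lambda>t. T (tan (t / 2)))"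
    proof (rule continuous_on_compose2[OF T_cont])
      show "continuous_on {0..pi / 2} (\<lambda>t::real. tan (t / 2))"
      proof (intro continuous_intros ballI)
        fix t :: real assume "t \<in> {0..pi / 2}"
        then show "cos (t / 2) \<noteq> 0"
          using cos_gt_zero_pi[of "t / 2"] pi_gt_zero by auto
      qed auto
      show "(\<lambda>t. tan (t / 2)) ` {0..pi / 2} \<subseteq> {0..1}"
      proof safe
        fix t :: real assume t: "t \<in> {0..pi / 2}"
        show "tan (t / 2) \<in> {0..1}"
        proof (cases "t = pi / 2")
          case True
          show ?thesis unfolding True by (simp add: tan_45)
        next
          case False
          then show ?thesis using t tan01[of t] by (cases "t = 0") auto
        qed
      qed
    qed
    then show "continuous_on {0..pi / 2} ?F" by (intro continuous_intros)
    fix t :: real assume "t \<in> {0<..<pi / 2}"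
    then have t: "0 < t" "t < pi / 2" by auto
    have cos: "cos (t / 2) > 0" using t by (intro cos_gt_zero_pi) auto
    have sin: "sin (t / 2) > 0" using t by (intro sin_gt_zero) auto
    have "(?F has_real_derivative 2 * (arctan (tan (t / 2)) / tan (t / 2)
        * (inverse ((cos (t / 2))\<^sup>2) * (1 / 2)))) (at t)"
      using cos by (intro DERIV_cmult DERIV_chain2[OF T_der] tan01 t)
        (auto intro!: derivative_eq_intros)
    also have "arctan (tan (t / 2)) = t / 2" using t by (intro arctan_tan) auto
    also have "2 * (t / 2 / tan (t / 2) * (inverse ((cos (t / 2))\<^sup>2) * (1 / 2))) = t / sin t"
      using sin cos sin_double[of "t / 2"]
      by (simp add: tan_def field_simps power2_eq_square)
    also have "t / sin t = ?g t"
    proof -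
      have st: "0 < sin t" "sin t < 1"
        using t sin_gt_zero[of t] sin_monotone_2pi[of t "pi / 2"] by auto
      have "summable (\<lambda>j. central_coeff j / (2 * real j + 1) * ((sin t)\<^sup>2) ^ j)"
      proof (rule summable_power_series_bounded)
        show "\<bar>(sin t)\<^sup>2\<bar> < 1" using st by (simp add: abs_square_less_1)
        show "\<bar>central_coeff j / (2 * real j + 1)\<bar> \<le> 1" for j
          using central_coeff_pos[of j] central_coeff_le_1[of j] by simp
      qed
      from suminf_mult[OF this[folded power_mult], of "sin t"]
      have "(\<Sum>j. central_coeff j / (2 * real j + 1) * sin t ^ (2 * j + 1)) = sin t * ?g t"
        by (simp add: mult_ac)
      moreover have "arcsin (sin t) = t" using t by (intro arcsin_sin) auto
      ultimately have "sin t * ?g t = t"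
        using arcsin_series[of "sin t"] st by simp
      then show ?thesis using st by (simp add: field_simps)
    qed
    finally show "(?F has_vector_derivative ?g t) (at t)"
      by (simp only: has_real_derivative_iff_has_vector_derivative)
  qed simp
  \<comment> \<open>At t = pi/2 powers of the sine give no decay, so the majorant must come from the
    coefficients alone.\<close>
  have u: "uniform_limit {0..pi / 2} (\<lambda>n t. \<Sum>j<n. central_coeff j / (2 * real j + 1) * sin t ^ (2 * j))
      ?g sequentially"
  proof (rule Weierstrass_m_test)
    show "summable (\<lambda>j. real (Suc j) powr (- 3 / 2))"
      by (subst summable_Suc_iff[of "\<lambda>j. real j powr (- 3 / 2)"])
        (simp add: summable_real_powr_iff)
    fix j and t :: real
    have "central_coeff j \<le> real (Suc j) powr (- 1 / 2)"
    proof (rule power2_le_imp_le)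
      show "(central_coeff j)\<^sup>2 \<le> (real (Suc j) powr (- 1 / 2))\<^sup>2"
        using central_coeff_square_le[of j]
        by (simp add: powr_minus_divide powr_half_sqrt power_divide add_ac)
    qed simp
    moreover have "1 / (2 * real j + 1) \<le> real (Suc j) powr (- 1)"
      by (simp add: powr_minus_divide frac_le)
    ultimately have "central_coeff j * (1 / (2 * real j + 1))
        \<le> real (Suc j) powr (- 1 / 2) * real (Suc j) powr (- 1)"
      by (intro mult_mono) auto
    also have "\<dots> = real (Suc j) powr (- 3 / 2)"
      unfolding powr_add[symmetric] by simp
    finally have le: "central_coeff j / (2 * real j + 1) \<le> real (Suc j) powr (- 3 / 2)" by simp
    have "norm (central_coeff j / (2 * real j + 1) * sin t ^ (2 * j))
        = central_coeff j / (2 * real j + 1) * \<bar>sin t\<bar> ^ (2 * j)"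
      using central_coeff_pos[of j] by (simp add: abs_mult power_abs)
    also have "\<dots> \<le> central_coeff j / (2 * real j + 1) * 1"
      using central_coeff_pos[of j] by (intro mult_left_mono power_le_one) auto
    finally show "norm (central_coeff j / (2 * real j + 1) * sin t ^ (2 * j))
        \<le> real (Suc j) powr (- 3 / 2)"
      using le by simp
  qed
  obtain I J where IJ:
      "\<And>n. ((\<lambda>t. \<Sum>j<n. central_coeff j / (2 * real j + 1) * sin t ^ (2 * j)) has_integral I n) {0..pi / 2}"
      "(?g has_integral J) {0..pi / 2}" "I \<longlonglongrightarrow> J"
    by (rule uniform_limit_integral[OF u]) (auto intro!: continuous_intros)
  have "I = (\<lambda>n. \<Sum>j<n. central_coeff j / (2 * real j + 1) * (pi / 2 * central_coeff j))"
    by (rule ext, rule has_integral_unique[OF IJ(1)])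
      (intro has_integral_sum has_integral_mult_right has_integral_sin_power finite_lessThan)
  with IJ(3) have "(\<lambda>j. central_coeff j / (2 * real j + 1) * (pi / 2 * central_coeff j)) sums J"
    by (simp only: sums_def)
  also have "(\<lambda>j. central_coeff j / (2 * real j + 1) * (pi / 2 * central_coeff j))
      = (\<lambda>j. pi / 2 * ((central_coeff j)\<^sup>2 / (2 * real j + 1)))"
    by (simp add: power2_eq_square mult_ac)
  finally have "(\<lambda>j. (central_coeff j)\<^sup>2 / (2 * real j + 1)) sums (J / (pi / 2))"
    by (drule_tac c = "pi / 2" in sums_divide)
      (simp only: nonzero_mult_div_cancel_left[OF pi_half_neq_zero])
  moreover have "J = 2 * (\<Sum>k. (- 1) ^ k / (2 * real k + 1)\<^sup>2)"
    using has_integral_unique[OF IJ(2) g]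
    by (simp add: T_def p_def tan_45 power2_eq_square)
  ultimately show ?thesis by (simp add: sums_iff)
qed

text \<open>Because of the shift by \<open>Suc\<close>, the odd integers sit at the even summation
  indices.\<close>

lemma dirichlet_L_2_chi_m1: "dirichlet_L 2 chi_m1 = (\<Sum>k. (- 1) ^ k / (2 * real k + 1)\<^sup>2)"
proof -
  have mono: "strict_mono (\<lambda>j::nat. 2 * j)" by (simp add: strict_mono_def)
  have "dirichlet_L 2 chi_m1 = (\<Sum>k. chi_m1 (Suc (2 * k)) * real (Suc (2 * k)) powr (- 2))"
    unfolding dirichlet_L_def
    by (subst suminf_mono_reindex[OF mono, symmetric]) (auto simp: chi_m1_def elim!: evenE)
  also have "\<dots> = (\<Sum>k. (- 1) ^ k / (2 * real k + 1)\<^sup>2)"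
    by (simp add: chi_m1_def powr_minus_divide add_ac)
  finally show ?thesis .
qed

lemma recessive_sol_0: "recessive_sol 0 = 1 / 2 * dirichlet_L 2 chi_m1"
proof -
  have "recessive_sol 0 = (\<Sum>j. (central_coeff j)\<^sup>2 / (2 * real j + 1)) * (pi / 2) / 4"
    by (simp add: recessive_sol_def recessive_term_def)
  then show ?thesis
    unfolding suminf_catalan_central_coeff dirichlet_L_2_chi_m1 by simp
qed

section \<open>Solutions of the recurrence and their growth\<close>

lemma apery_like_rec_unique:
  assumes "apery_like_rec u" "apery_like_rec v" "u 0 = v 0" "u 1 = v 1"
  shows "u n = v n"
proof (induction n rule: induct_nat_012)
  case (ge2 n)
  have IH: "u (n + 1) = v (n + 1)" "u n = v n" using ge2 by simp_all
  have "(real n + 2)\<^sup>2 * u (n + 2) = (real n + 2)\<^sup>2 * v (n + 2)"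
    using assms(1,2)[unfolded apery_like_rec_def, THEN spec, of n] unfolding IH by linarith
  moreover have "(real n + 2)\<^sup>2 \<noteq> 0" by simp
  ultimately show ?case by simp
qed (use assms in simp_all)

lemma apery_like_rec_linear:
  assumes "apery_like_rec u" "apery_like_rec v"
  shows "apery_like_rec (\<lambda>n. c * u n - v n)"
  unfolding apery_like_rec_def
proof
  fix n
  have "c * ((real n + 2)\<^sup>2 * u (n + 2) - (32 * (real n)\<^sup>2 + 96 * real n + 76) * u (n + 1)
        + 256 * (real n + 1)\<^sup>2 * u n) = 0"
    "(real n + 2)\<^sup>2 * v (n + 2) - (32 * (real n)\<^sup>2 + 96 * real n + 76) * v (n + 1)
        + 256 * (real n + 1)\<^sup>2 * v n = 0"
    using assms unfolding apery_like_rec_def by simp_all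
  then show "(real n + 2)\<^sup>2 * (c * u (n + 2) - v (n + 2))
      - (32 * (real n)\<^sup>2 + 96 * real n + 76) * (c * u (n + 1) - v (n + 1))
      + 256 * (real n + 1)\<^sup>2 * (c * u n - v n) = 0"
    by (simp add: algebra_simps)
qed

lemma apery_like_rec_recessive: "apery_like_rec (\<lambda>n. 16 ^ n * recessive_sol n)"
  unfolding apery_like_rec_def
proof
  fix n
  have "256 * 16 ^ n * ((real n + 2)\<^sup>2 * recessive_sol (n + 2)
      - (2 * (real n)\<^sup>2 + 6 * real n + 19 / 4) * recessive_sol (n + 1)
      + (real n + 1)\<^sup>2 * recessive_sol n) = 0"
    unfolding recessive_sol_rec by simp
  then show "(real n + 2)\<^sup>2 * (16 ^ (n + 2) * recessive_sol (n + 2))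
      - (32 * (real n)\<^sup>2 + 96 * real n + 76) * (16 ^ (n + 1) * recessive_sol (n + 1))
      + 256 * (real n + 1)\<^sup>2 * (16 ^ n * recessive_sol n) = 0"
    by (simp add: algebra_simps)
qed

text \<open>In the step the middle coefficient cancels, so the weighted determinant is multiplied by
  256.\<close>

lemma casoratian:
  assumes "apery_like_rec u" "apery_like_rec v"
  shows "(real n + 1)\<^sup>2 * (u (Suc n) * v n - u n * v (Suc n)) = 256 ^ n * (u 1 * v 0 - u 0 * v 1)"
proof (induction n)
  case (Suc n)
  let ?B = "32 * (real n)\<^sup>2 + 96 * real n + 76"
  have u: "(real n + 2)\<^sup>2 * u (n + 2) = ?B * u (n + 1) - 256 * (real n + 1)\<^sup>2 * u n"
    and v: "(real n + 2)\<^sup>2 * v (n + 2) = ?B * v (n + 1) - 256 * (real n + 1)\<^sup>2 * v n"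
    using assms[unfolded apery_like_rec_def, THEN spec, of n] by simp_all
  have "(real (Suc n) + 1)\<^sup>2 * (u (Suc (Suc n)) * v (Suc n) - u (Suc n) * v (Suc (Suc n)))
      = ((real n + 2)\<^sup>2 * u (n + 2)) * v (n + 1) - u (n + 1) * ((real n + 2)\<^sup>2 * v (n + 2))"
    by (simp add: algebra_simps)
  also have "\<dots> = 256 * ((real n + 1)\<^sup>2 * (u (Suc n) * v n - u n * v (Suc n)))"
    unfolding u v by (simp add: algebra_simps)
  finally show ?case unfolding Suc.IH by simp
qed simp

theorem theorem3:
  fixes a b :: "nat \<Rightarrow> real"
  assumes "apery_like_rec a" and "a 0 = 1" and "a 1 = 12"
    and "apery_like_rec b" and "b 0 = 0" and "b 1 = 1"
  shows "(\<lambda>n. \<bar>b n / a n - 1 / 2 * dirichlet_L 2 chi_m1\<bar>) \<in> O(\<lambda>n. 1 / ln (real n))"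
proof -
  let ?L = "1 / 2 * dirichlet_L 2 chi_m1"
  define q where "q n = 16 ^ n * recessive_sol n" for n
  have q_pos: "q n > 0" for n by (simp add: q_def recessive_sol_pos)
  have q_rec: "apery_like_rec q"
    unfolding q_def by (rule apery_like_rec_recessive)
  have q0: "q 0 = ?L" and q1: "q 1 = 12 * ?L - 1"
    using recessive_sol_1 by (simp_all add: q_def recessive_sol_0)
  \<comment> \<open>The values at 0 and 1 match: \<open>?L * 1 - ?L = 0\<close> and
    \<open>?L * 12 - (12 * ?L - 1) = 1\<close>.\<close>
  have b: "b n = ?L * a n - q n" for n
    by (rule apery_like_rec_unique[OF assms(4) apery_like_rec_linear[OF assms(1) q_rec]])
      (use assms(2,3,5,6) q0 q1 in simp_all)
  have increment: "a (Suc n) / q (Suc n) \<ge> a n / q n + 1 / (16 * real n)" if "n \<ge> 1" for n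
  proof -
    \<comment> \<open>The initial determinant is \<open>12 * ?L - (12 * ?L - 1) = 1\<close>.\<close>
    have "(real n + 1)\<^sup>2 * (a (Suc n) * q n - a n * q (Suc n)) = 256 ^ n"
      using casoratian[OF assms(1) q_rec, of n] assms(2,3) q0 q1 by simp
    then have "a (Suc n) / q (Suc n) - a n / q n = 256 ^ n / ((real n + 1)\<^sup>2 * (q n * q (Suc n)))"
      using q_pos[of n] q_pos[of "Suc n"] by (simp add: field_simps)
    also have "q n * q (Suc n) = 16 * 256 ^ n * (recessive_sol n * recessive_sol (Suc n))"
      by (simp add: q_def flip: power_mult_distrib)
    also have "256 ^ n / ((real n + 1)\<^sup>2 * (16 * 256 ^ n * (recessive_sol n * recessive_sol (Suc n))))
        = 1 / (16 * (real n + 1)\<^sup>2 * (recessive_sol n * recessive_sol (Suc n)))"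
      by simp
    \<comment> \<open>From n + 1 <= 2n and the bound on the product, the denominator is at most 16 *
      4n^2 / (4n) = 16n.\<close>
    also have "\<dots> \<ge> 1 / (16 * (2 * real n)\<^sup>2 * (1 / (4 * real n)))"
      using that recessive_sol_pos[of n] recessive_sol_pos[of "Suc n"]
      by (intro divide_left_mono mult_mono recessive_sol_mult_Suc_le power_mono mult_pos_pos) auto
    finally show ?thesis
      using that by (simp add: power2_eq_square)
  qed
  \<comment> \<open>Summing the increments gives a harmonic sum, compared with the logarithm; at n =
    1 the logarithm is 0 and \<open>a 1\<close> is positive.\<close>
  have lower: "a n / q n \<ge> ln (real n) / 16" if "n \<ge> 1" for n
    using that
  proof (induction n rule: dec_induct)
    case base
    then show ?case using q_pos[of 1] assms(3) by simp
  next
    case (step n)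
    have "ln (real (Suc n)) - ln (real n) \<le> 1 / real n"
      using ln_diff_le[of "real (Suc n)" "real n"] step by simp
    then have "ln (real (Suc n)) / 16 \<le> ln (real n) / 16 + 1 / (16 * real n)"
      by simp
    then show ?case
      using increment[of n] step by linarith
  qed
  have "\<bar>b n / a n - ?L\<bar> \<le> 16 * \<bar>1 / ln (real n)\<bar>" if "n \<ge> 2" for n
  proof -
    have ln: "ln (real n) > 0" using that by simp
    have le: "ln (real n) / 16 \<le> a n / q n" using lower[of n] that by simp
    \<comment> \<open>Positivity of \<open>a n\<close>, needed for the division, comes from the
      lower bound itself.\<close>
    with ln have "a n / q n > 0" by linarith
    then have a_pos: "a n > 0" using q_pos[of n] by (simp add: zero_less_divide_iff)
    have "b n / a n - ?L = - (q n / a n)"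
      unfolding b using a_pos by (simp add: field_simps)
    also have "\<bar>\<dots>\<bar> = inverse (a n / q n)" using a_pos q_pos[of n] by simp
    also have "\<dots> \<le> inverse (ln (real n) / 16)" using le ln by (intro le_imp_inverse_le) auto
    finally show ?thesis using ln by (simp add: field_simps)
  qed
  then show ?thesis
    by (intro bigoI[where c = 16] eventually_sequentiallyI[of 2]) simp
qed

end
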